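(* For every positive integer $m$, \[\sum_{n=1}^\infty\frac{Y_m(n)}{n}(-1)^{n-1}=m!\,\mathrm{Li}_{m+1}\left(\tfrac12\right),\] \[\sum_{n=1}^\infty\frac{Y_{m-1}(n)\,\bar H_n}{n}(-1)^{n-1}=m!\left(\zeta(m+1)-\mathrm{Li}_{m+1}\left(\tfrac12\right)\right),\] \[\sum_{n=m}^\infty\frac{\bar H_n\,s(n,m)}{n!}(-1)^{n-1}=\mathrm{Li}_{m+1}\left(\tfrac12\right)-\frac{(-1)^m}{m!}\ln^{m+1}2.\]
   Context: $H_n^{(p)}=\sum_{j=1}^n j^{-p}$, $\bar H_n=\sum_{j=1}^n(-1)^{j-1}/j$, $\mathrm{Li}_p(x)=\sum_{n\ge1}x^n/n^p$, and $\zeta$ is the Riemann zeta function. The numbers $Y_k(n)$ are defined by $Y_k(n)=Y_k(H_n,1!H_n^{(2)},\ldots,(k-1)!H_n^{(k)})$, where $Y_k(x_1,\ldots,x_k)$ are the exponential complete Bell polynomials, $\exp\left(\sum_{m\ge1}x_mt^m/m!\right)=1+\sum_{k\ge1}Y_k(x_1,\ldots,x_k)t^k/k!$; equivalently $Y_0(n)=1$ and $Y_k(n)=\sum_{j=0}^{k-1}\binom{k-1}{j}(k-j-1)!\,H_n^{(k-j)}Y_j(n)$ for $k\ge1$. $s(n,k)$ denotes the unsigned Stirling numbers of the first kind, with $\ln^k(1-x)=(-1)^kk!\sum_{n\ge k}s(n,k)x^n/n!$. Infinite sums are limits of partial sums (they may converge only conditionally). *)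

theory Defs
  imports
    "HOL-Analysis.Analysis"
    "HOL-Combinatorics.Stirling"
    "HOL-Computational_Algebra.Computational_Algebra"
begin

definition gen_harm :: "nat \<Rightarrow> nat \<Rightarrow> real" where
  "gen_harm p n = (\<Sum>j=1..n. 1 / real j ^ p)"

definition alt_harm :: "nat \<Rightarrow> real" where
  "alt_harm n = (\<Sum>j=1..n. (-1) ^ (j - 1) / real j)"

text \<open>The series defining the polylogarithm; used for \<open>\<bar>x\<bar> < 1\<close> only.\<close>

definition polylog :: "nat \<Rightarrow> real \<Rightarrow> real" where
  "polylog p x = (\<Sum>n. x ^ Suc n / real (Suc n) ^ p)"

text \<open>The Dirichlet series of the Riemann zeta function, which agrees with it for \<open>s > 1\<close>; for
  other real \<open>s\<close> the series diverges and the value is meaningless.\<close>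

definition riemann_zeta :: "real \<Rightarrow> real" where
  "riemann_zeta s = (\<Sum>n. 1 / real (Suc n) powr s)"

text \<open>\<open>k!\<close> times the coefficient of \<open>t\<^sup>k\<close> in \<open>exp (\<Sum>m\<ge>1. x\<^sub>m t\<^sup>m / m!)\<close>. The argument \<open>x 0\<close> is
  ignored.\<close>

definition complete_bell :: "nat \<Rightarrow> (nat \<Rightarrow> real) \<Rightarrow> real" where
  "complete_bell k x =
     fact k * fps_nth (fps_exp 1 oo Abs_fps (\<lambda>m. if m = 0 then 0 else x m / fact m)) k"

definition Y :: "nat \<Rightarrow> nat \<Rightarrow> real" where
  "Y k n = complete_bell k (\<lambda>j. fact (j - 1) * gen_harm j n)"

lemma complete_bell_0: "complete_bell 0 x = 1"
  by (simp add: complete_bell_def)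

lemma complete_bell_Suc:
  "complete_bell (Suc k) x = (\<Sum>j\<le>k. real (k choose j) * x (Suc k - j) * complete_bell j x)"
proof -
  define G where "G = Abs_fps (\<lambda>m. if m = 0 then 0 else x m / fact m)"
  define F where "F = fps_exp (1::real) oo G"
  have G0: "fps_nth G 0 = 0" by (simp add: G_def)
  have "fps_deriv F = F * fps_deriv G"
    unfolding F_def using G0 by (simp add: fps_compose_deriv)
  hence "fps_nth (fps_deriv F) k = (\<Sum>j=0..k. fps_nth F j * fps_nth (fps_deriv G) (k - j))"
    by (simp add: fps_mult_nth)
  hence "fact k * (real (Suc k) * fps_nth F (Suc k)) =
      (\<Sum>j=0..k. fact k * (fps_nth F j * fps_nth (fps_deriv G) (k - j)))"
    by (simp add: sum_distrib_left)
  also have "\<dots> = (\<Sum>j=0..k. real (k choose j) * x (Suc k - j) * (fact j * fps_nth F j))"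
  proof (rule sum.cong)
    fix j assume "j \<in> {0..k}"
    hence j: "j \<le> k" by simp
    have eq: "fps_nth (fps_deriv G) (k - j) = x (Suc k - j) / fact (k - j)"
      using j by (simp add: G_def Suc_diff_le field_simps del: of_nat_Suc)
    thus "fact k * (fps_nth F j * fps_nth (fps_deriv G) (k - j)) =
        real (k choose j) * x (Suc k - j) * (fact j * fps_nth F j)"
      using j unfolding eq by (simp add: binomial_fact)
  qed simp
  finally show ?thesis
    by (simp add: complete_bell_def F_def G_def atMost_atLeast0 algebra_simps)
qed

lemma Y_0: "Y 0 n = 1"
  by (simp add: Y_def complete_bell_0)

lemma Y_rec:
  assumes "k \<ge> 1"
  shows "Y k n = (\<Sum>j=0..k-1. real ((k - 1) choose j) * fact (k - j - 1) * gen_harm (k - j) n * Y j n)"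
proof -
  obtain l where "k = Suc l" using assms by (cases k) auto
  thus ?thesis by (simp add: Y_def complete_bell_Suc atMost_atLeast0 mult.assoc)
qed

end

(* Y_k(n) is k! times the complete homogeneous symmetric polynomial h_k(1, 1/2, ..., 1/n), and
   h_k(n)/n is the moment E[(1-u)^(n-1)] of the measure (-ln u)^k/k! du on [0,1], whose moments
   E[u^i] are 1/(i+1)^(k+1). So the first sum is E[1/(2-u)] and the second is
   E[-ln u / ((1-u)(2-u))]; expanding these in powers of u gives polylogarithms at 1/2 and zeta
   values. The third sum follows from Hbar_n = ln 2 - (-1)^n * integral of (1-u)^n/(2-u) and the
   exponential generating function of the Stirling numbers. All mixed moments E[u^i (1-u)^n] are
   iterated differences of the sequence 1/(i+1)^(k+1), so no integration is required: the needed
   expansions are telescoping sums and interchanges of nonnegative double series. *)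
theory Submission
  imports Defs
begin

section \<open>Interchange of nonnegative double series\<close>

text \<open>Nonnegativity turns each \<open>sums\<close> into an unconditional
  \<open>has_sum\<close>, so Tonelli applies; convergence of the series of row sums comes out as
  part of the conclusion.\<close>

lemma sums_nonneg_swap:
  fixes f :: "nat \<Rightarrow> nat \<Rightarrow> real"
  assumes nonneg: "\<And>n i. f n i \<ge> 0"
    and rows: "\<And>n. f n sums g n"
    and cols: "\<And>i. (\<lambda>n. f n i) sums c i"
    and total: "c sums S"
  shows "g sums S"
proof -
  have c_nonneg: "c i \<ge> 0" for i
    using sums_le[OF _ sums_zero cols[of i]] nonneg by simp
  have "((\<lambda>(i, n). f n i) has_sum S) (UNIV \<times> UNIV)"
  proof (rule has_sum_SigmaI[where g = c])
    show "((\<lambda>n. case (i, n) of (i, n) \<Rightarrow> f n i) has_sum c i) UNIV" for i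
      using sums_nonneg_imp_has_sum[OF cols nonneg] by simp
    show "(c has_sum S) UNIV"
      by (rule sums_nonneg_imp_has_sum[OF total c_nonneg])
    show "(\<lambda>(i, n). f n i) summable_on UNIV \<times> UNIV"
    proof (rule summable_on_SigmaI[where g = c])
      show "((\<lambda>n. case (i, n) of (i, n) \<Rightarrow> f n i) has_sum c i) UNIV" for i
        using sums_nonneg_imp_has_sum[OF cols nonneg] by simp
      show "c summable_on UNIV"
        using sums_nonneg_imp_has_sum[OF total c_nonneg] by (rule has_sum_imp_summable)
    qed (use nonneg in auto)
  qed
  hence "((\<lambda>(n, i). f n i) has_sum S) (UNIV \<times> UNIV)"
    by (subst (asm) has_sum_swap) simp
  hence "(g has_sum S) UNIV"
    by (rule has_sum_SigmaD) (use sums_nonneg_imp_has_sum[OF rows nonneg] in auto)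
  thus ?thesis by (rule has_sum_imp_sums)
qed

section \<open>Complete homogeneous symmetric polynomials and Bell polynomials\<close>

text \<open>The product of the geometric series 1/(1 - t/j), whose coefficients are the complete
  homogeneous symmetric polynomials in 1, 1/2, ..., 1/n.\<close>

definition h_gf :: "nat \<Rightarrow> real fps" where
  "h_gf n = (\<Prod>j=1..n. Abs_fps (\<lambda>k. 1 / real j ^ k))"

definition h :: "nat \<Rightarrow> nat \<Rightarrow> real" where
  "h k n = fps_nth (h_gf n) k"

lemma h_gf_Suc: "h_gf (Suc n) = h_gf n * Abs_fps (\<lambda>k. 1 / real (Suc n) ^ k)"
  by (simp add: h_gf_def)

lemma h_0_left [simp]: "h 0 n = 1"
  unfolding h_def by (induction n) (simp_all add: h_gf_Suc, simp add: h_gf_def)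

lemma h_0_right [simp]: "h (Suc k) 0 = 0"
  by (simp add: h_def h_gf_def)

text \<open>A monomial either avoids the variable 1/(n+1) or contains a factor of it that can be
  split off.\<close>

lemma h_Suc_Suc: "h (Suc k) (Suc n) = h (Suc k) n + h k (Suc n) / real (Suc n)"
proof -
  have "h (Suc k) (Suc n) = (\<Sum>i\<le>Suc k. h i n * (1 / real (Suc n) ^ (Suc k - i)))"
    by (simp add: h_def h_gf_Suc fps_mult_nth atMost_atLeast0 del: of_nat_Suc)
  also have "\<dots> = h (Suc k) n + (\<Sum>i\<le>k. h i n * (1 / real (Suc n) ^ (Suc k - i)))"
    by simp
  also have "(\<Sum>i\<le>k. h i n * (1 / real (Suc n) ^ (Suc k - i)))
      = (\<Sum>i\<le>k. h i n * (1 / real (Suc n) ^ (k - i))) / real (Suc n)"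
    unfolding sum_divide_distrib by (rule sum.cong) (auto simp: Suc_diff_le)
  also have "(\<Sum>i\<le>k. h i n * (1 / real (Suc n) ^ (k - i))) = h k (Suc n)"
    by (simp add: h_def h_gf_Suc fps_mult_nth atMost_atLeast0 del: of_nat_Suc)
  finally show ?thesis .
qed

lemma h_nonneg: "h k n \<ge> 0"
proof (induction k arbitrary: n)
  case (Suc k)
  show ?case by (induction n) (simp_all add: h_Suc_Suc Suc del: of_nat_Suc)
qed simp

lemma h_mono: "h k n \<le> h k (Suc n)"
  by (cases k) (simp_all add: h_Suc_Suc h_nonneg del: of_nat_Suc)

text \<open>The logarithmic derivative of 1/(1 - t/j) has coefficients 1/j^(k+1); adding over j
  gives the power sums.\<close>

lemma fps_deriv_h_gf: "fps_deriv (h_gf n) = h_gf n * Abs_fps (\<lambda>k. gen_harm (Suc k) n)"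
proof (induction n)
  case 0
  show ?case by (simp add: h_gf_def gen_harm_def fps_eq_iff fps_mult_nth)
next
  case (Suc n)
  define G where "G = Abs_fps (\<lambda>k. 1 / real (Suc n) ^ k)"
  define D where "D = Abs_fps (\<lambda>k. 1 / real (Suc n) ^ Suc k)"
  have G': "fps_deriv G = G * D"
  proof (rule fps_ext)
    fix k
    have "fps_nth (G * D) k = (\<Sum>i=0..k. 1 / real (Suc n) ^ Suc k)"
      unfolding fps_mult_nth G_def D_def
      by (rule sum.cong) (auto simp flip: power_add simp del: of_nat_Suc power_Suc)
    thus "fps_nth (fps_deriv G) k = fps_nth (G * D) k"
      by (simp add: G_def del: power_Suc)
  qed
  have H: "Abs_fps (\<lambda>k. gen_harm (Suc k) (Suc n)) = Abs_fps (\<lambda>k. gen_harm (Suc k) n) + D"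
    by (simp add: fps_eq_iff D_def gen_harm_def del: power_Suc)
  show ?case
    unfolding h_gf_Suc G_def[symmetric] H fps_deriv_mult Suc G' by (simp add: algebra_simps)
qed

text \<open>Newton's identity, read off from the logarithmic derivative.\<close>

lemma h_newton: "real (Suc k) * h (Suc k) n = (\<Sum>j\<le>k. h j n * gen_harm (Suc k - j) n)"
proof -
  have "real (Suc k) * h (Suc k) n = fps_nth (fps_deriv (h_gf n)) k"
    by (simp add: h_def)
  also have "\<dots> = (\<Sum>j\<le>k. h j n * gen_harm (Suc (k - j)) n)"
    unfolding fps_deriv_h_gf by (simp add: fps_mult_nth h_def atMost_atLeast0)
  also have "\<dots> = (\<Sum>j\<le>k. h j n * gen_harm (Suc k - j) n)"
    by (rule sum.cong) (auto simp: Suc_diff_le)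
  finally show ?thesis .
qed

text \<open>Substituting k! h_k into \<open>Y_rec\<close> cancels the binomial coefficients and
  leaves \<open>h_newton\<close>.\<close>

lemma Y_eq_h: "Y k n = fact k * h k n"
proof (induction k rule: less_induct)
  case (less k)
  show ?case
  proof (cases k)
    case 0
    thus ?thesis by (simp add: Y_0)
  next
    case (Suc l)
    have "Y k n = (\<Sum>j\<le>l. real (l choose j) * fact (l - j) * gen_harm (Suc l - j) n * Y j n)"
      using Y_rec[of k n] by (simp add: Suc atMost_atLeast0 del: of_nat_Suc)
    also have "\<dots> = (\<Sum>j\<le>l. fact l * (h j n * gen_harm (Suc l - j) n))"
    proof (rule sum.cong)
      fix j assume "j \<in> {..l}"
      thus "real (l choose j) * fact (l - j) * gen_harm (Suc l - j) n * Y j n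
          = fact l * (h j n * gen_harm (Suc l - j) n)"
        using less[of j] Suc by (simp add: binomial_fact)
    qed simp
    also have "\<dots> = fact l * (real (Suc l) * h (Suc l) n)"
      by (simp add: h_newton flip: sum_distrib_left del: of_nat_Suc)
    finally show ?thesis by (simp add: Suc algebra_simps)
  qed
qed

section \<open>Moments as iterated differences\<close>

text \<open>For \<open>K > 0\<close>, \<open>mu K i n\<close> is \<open>1 / (K - 1)!\<close> times the integral of
  \<open>u ^ i * (1 - u) ^ n * (- ln u) ^ (K - 1)\<close> over \<open>[0, 1]\<close>.\<close>

fun mu :: "nat \<Rightarrow> nat \<Rightarrow> nat \<Rightarrow> real" where
  "mu K i 0 = 1 / real (Suc i) ^ K"
| "mu K i (Suc n) = mu K i n - mu K (Suc i) n"

declare mu.simps(2) [simp del]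

text \<open>Integration by parts, with u^i integrated and (1 - u)^n (-ln u)^K / K! differentiated,
  but proved on differences. At n = 0 the truncated \<open>n - 1\<close> is multiplied by 0.\<close>

lemma mu_rec: "real (Suc i) * mu (Suc K) i n = mu K i n + real n * mu (Suc K) (Suc i) (n - 1)"
proof (induction n arbitrary: i)
  case 0
  show ?case by simp
next
  case (Suc n)
  have 1: "real (Suc i) * mu (Suc K) i n = mu K i n + real n * mu (Suc K) (Suc i) (n - 1)"
    by (rule Suc)
  have 2: "real (Suc (Suc i)) * mu (Suc K) (Suc i) n
      = mu K (Suc i) n + real n * mu (Suc K) (Suc (Suc i)) (n - 1)"
    by (rule Suc)
  have 3: "real n * mu (Suc K) (Suc i) n
      = real n * mu (Suc K) (Suc i) (n - 1) - real n * mu (Suc K) (Suc (Suc i)) (n - 1)"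
    by (cases n) (simp_all add: mu.simps(2) algebra_simps)
  have "real (Suc i) * mu (Suc K) i (Suc n) = real (Suc i) * mu (Suc K) i n
      - (real (Suc (Suc i)) * mu (Suc K) (Suc i) n - mu (Suc K) (Suc i) n)"
    by (simp add: mu.simps(2) algebra_simps)
  also have "\<dots> = mu K i n - mu K (Suc i) n + (real n * mu (Suc K) (Suc i) n + mu (Suc K) (Suc i) n)"
    unfolding 1 2 3 by simp
  also have "\<dots> = mu K i (Suc n) + real (Suc n) * mu (Suc K) (Suc i) (Suc n - 1)"
    by (simp add: mu.simps(2) distrib_right)
  finally show ?case .
qed

text \<open>Writing u = 1 - (1 - u) in the last moment keeps i fixed and leaves a recurrence with
  nonnegative coefficients.\<close>

lemma mu_rec': "real (Suc i + n) * mu (Suc K) i n = mu K i n + real n * mu (Suc K) i (n - 1)"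
  using mu_rec[of i K n] by (cases n) (simp_all add: mu.simps(2) algebra_simps)

text \<open>K = 0 is the point mass at u = 1, where (1 - u)^(n+1) vanishes.\<close>

lemma mu_0_Suc [simp]: "mu 0 i (Suc n) = 0"
  by (induction n arbitrary: i) (simp_all add: mu.simps(2)[of 0])

text \<open>Complete monotonicity of 1/(i+1)^K, from \<open>mu_rec'\<close> by induction on K and
  n.\<close>

lemma mu_nonneg: "mu K i n \<ge> 0"
proof (induction K arbitrary: n)
  case 0
  show ?case by (cases n) simp_all
next
  case (Suc K)
  show ?case
  proof (induction n)
    case (Suc n)
    have "real (Suc i + Suc n) * mu (Suc K) i (Suc n) \<ge> 0"
      unfolding mu_rec' using Suc \<open>\<And>n. 0 \<le> mu K i n\<close> by (simp add: del: of_nat_Suc)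
    thus ?case by (simp add: zero_le_mult_iff)
  qed simp
qed

lemma mu_antimono_i: "mu K (Suc i) n \<le> mu K i n"
  using mu_nonneg[of K i "Suc n"] by (simp add: mu.simps(2))

lemma mu_le_0: "mu K i n \<le> mu K 0 n"
  by (induction i) (auto intro: order_trans[OF mu_antimono_i])

lemma mu_le_power: "mu K i n \<le> 1 / real (Suc i) ^ K"
proof (induction n)
  case (Suc n)
  thus ?case using mu_nonneg[of K "Suc i" n] by (simp add: mu.simps(2) del: of_nat_Suc)
qed simp

lemma mu_le_1: "mu K i n \<le> 1"
  using mu_le_power[of K i n] by (rule order_trans) (simp add: divide_le_eq_1 one_le_power)

text \<open>Under this substitution \<open>mu_rec'\<close> at i = 0 becomes
  \<open>h_Suc_Suc\<close>.\<close>

lemma h_eq_mu: "h K (Suc n) = real (Suc n) * mu (Suc K) 0 n"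
proof (induction K arbitrary: n)
  case 0
  show ?case
  proof (induction n)
    case (Suc n)
    thus ?case using mu_rec'[of 0 "Suc n" 0] by simp
  qed simp
next
  case (Suc K)
  show ?case
  proof (induction n)
    case 0
    show ?case by (simp add: h_Suc_Suc Suc)
  next
    case (Suc n)
    have "h (Suc K) (Suc (Suc n)) = h (Suc K) (Suc n) + mu (Suc K) 0 (Suc n)"
      unfolding h_Suc_Suc[of K "Suc n"] \<open>\<And>n. h K (Suc n) = real (Suc n) * mu (Suc K) 0 n\<close>
      by (simp add: add_nonneg_eq_0_iff)
    thus ?case using Suc mu_rec'[of 0 "Suc n" "Suc K"] by simp
  qed
qed

text \<open>A crude bound, enough for h_K(n)/n to tend to 0. Raising K sums terms 1/sqrt(n), each at
  most 2(sqrt(n) - sqrt(n-1)), which costs one factor 2.\<close>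

lemma h_le_sqrt: "h K (Suc n) \<le> 2 ^ K * sqrt (real (Suc n))"
proof (induction K arbitrary: n)
  case (Suc K)
  show ?case
  proof (induction n)
    case 0
    have "h K (Suc 0) \<le> 2 ^ K" using Suc[of 0] by simp
    hence "h K (Suc 0) \<le> 2 * 2 ^ K" using zero_le_power[of "2::real" K] by linarith
    thus ?case by (simp add: h_Suc_Suc)
  next
    case (Suc n)
    define a b where "a = sqrt (real (Suc n))" and "b = sqrt (real (Suc (Suc n)))"
    have b2: "b * b = real (Suc (Suc n))" and a2: "a * a = real (Suc n)"
      unfolding a_def b_def by (simp_all del: of_nat_Suc)
    have pos: "b > 0" "a \<ge> 0" "a \<le> b" unfolding a_def b_def by simp_all
    have "1 = (b - a) * (b + a)" using a2 b2 by (simp add: algebra_simps)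
    also have "\<dots> \<le> (b - a) * (2 * b)" using pos by (intro mult_left_mono) auto
    finally have step: "1 / b \<le> 2 * (b - a)" using pos by (simp add: field_simps)
    have "h (Suc K) (Suc (Suc n)) = h (Suc K) (Suc n) + h K (Suc (Suc n)) / real (Suc (Suc n))"
      by (rule h_Suc_Suc)
    also have "\<dots> \<le> 2 ^ Suc K * a + 2 ^ K * b / real (Suc (Suc n))"
      using Suc \<open>h K (Suc (Suc n)) \<le> _\<close> unfolding a_def b_def
      by (intro add_mono divide_right_mono) (simp_all del: of_nat_Suc)
    also have "2 ^ K * b / real (Suc (Suc n)) = 2 ^ K * (1 / b)"
      unfolding b2[symmetric] using pos by simp
    also have "2 ^ Suc K * a + \<dots> \<le> 2 ^ Suc K * a + 2 ^ K * (2 * (b - a))"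
      using step by (intro add_left_mono mult_left_mono) auto
    also have "\<dots> = 2 ^ Suc K * b" by (simp add: algebra_simps)
    finally show ?case unfolding b_def .
  qed
qed (simp add: real_le_rsqrt)

lemma mu_tendsto_n: "(\<lambda>n. mu (Suc K) i n) \<longlonglongrightarrow> 0"
proof (rule tendsto_sandwich[of "\<lambda>_. 0" _ _ "\<lambda>n. 2 ^ K * (1 / sqrt (real (Suc n)))"])
  have "mu (Suc K) i n \<le> 2 ^ K * (1 / sqrt (real (Suc n)))" for n
  proof -
    have "real (Suc n) * mu (Suc K) 0 n \<le> 2 ^ K * sqrt (real (Suc n))"
      using h_le_sqrt[of K n] unfolding h_eq_mu .
    hence "mu (Suc K) 0 n \<le> 2 ^ K * sqrt (real (Suc n)) / real (Suc n)"
      by (simp add: field_simps del: of_nat_Suc)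
    also have "\<dots> = 2 ^ K * (1 / sqrt (real (Suc n)))"
      using sqrt_divide_self_eq[of "real (Suc n)"]
      by (simp add: inverse_eq_divide flip: times_divide_eq_right del: of_nat_Suc)
    finally show ?thesis using mu_le_0[of "Suc K" i n] by linarith
  qed
  thus "eventually (\<lambda>n. mu (Suc K) i n \<le> 2 ^ K * (1 / sqrt (real (Suc n)))) sequentially" by simp
  have "(\<lambda>n. sqrt (1 / real (Suc n))) \<longlonglongrightarrow> sqrt 0"
    by (intro tendsto_real_sqrt) (rule LIMSEQ_Suc[OF lim_1_over_n])
  hence "(\<lambda>n. 2 ^ K * (1 / sqrt (real (Suc n)))) \<longlonglongrightarrow> 2 ^ K * 0"
    by (intro tendsto_mult_left) (simp add: real_sqrt_divide)
  thus "(\<lambda>n. 2 ^ K * (1 / sqrt (real (Suc n)))) \<longlonglongrightarrow> 0" by simp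
qed (simp_all add: mu_nonneg)

lemma mu_tendsto_i: "(\<lambda>i. mu (Suc K) i n) \<longlonglongrightarrow> 0"
proof (rule tendsto_sandwich[of "\<lambda>_. 0" _ _ "\<lambda>i. 1 / real (Suc i)"])
  have "mu (Suc K) i n \<le> 1 / real (Suc i)" for i
  proof -
    have "mu (Suc K) i n \<le> 1 / real (Suc i) ^ Suc K" by (rule mu_le_power)
    also have "\<dots> \<le> 1 / real (Suc i)"
      using power_increasing[of 1 "Suc K" "real (Suc i)"]
      by (intro divide_left_mono) (auto simp del: of_nat_Suc)
    finally show ?thesis .
  qed
  thus "eventually (\<lambda>i. mu (Suc K) i n \<le> 1 / real (Suc i)) sequentially" by simp
  show "(\<lambda>i. 1 / real (Suc i)) \<longlonglongrightarrow> 0"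
    by (rule LIMSEQ_Suc[OF lim_1_over_n])
qed (simp_all add: mu_nonneg)

text \<open>The sum of u^i (1 - u) over i is 1 except at u = 1; \<open>Suc K\<close> excludes the
  point mass there.\<close>

lemma mu_sums_i: "(\<lambda>i. mu (Suc K) i (Suc n)) sums mu (Suc K) 0 n"
  using telescope_sums'[OF mu_tendsto_i[of K n]] by (simp add: mu.simps(2))

text \<open>The integral of \<open>- u ^ i * ln u\<close> against that measure, with \<open>- ln u\<close> expanded in powers of \<open>1 - u\<close>.\<close>

lemma mu_div_sums: "(\<lambda>n. mu K i (Suc n) / real (Suc n)) sums (real K / real (Suc i) ^ Suc K)"
proof (induction K)
  case 0
  show ?case by simp
next
  case (Suc K)
  define c where "c = real (Suc i)"
  have c: "c > 0" by (simp add: c_def)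
  \<comment> \<open>By \<open>mu_rec\<close> divided by \<open>Suc n\<close>, the term for
    \<open>Suc K\<close> times c is the term for K plus this telescoping difference.\<close>
  have "(\<lambda>n. mu (Suc K) i n - mu (Suc K) i (Suc n)) sums (mu (Suc K) i 0 - 0)"
    by (rule telescope_sums'[OF mu_tendsto_n])
  hence "(\<lambda>n. 1 / c * (mu K i (Suc n) / real (Suc n) + (mu (Suc K) i n - mu (Suc K) i (Suc n))))
      sums (1 / c * (real K / c ^ Suc K + 1 / c ^ Suc K))"
    using Suc unfolding c_def by (intro sums_mult sums_add) (simp_all del: of_nat_Suc)
  moreover have "1 / c * (mu K i (Suc n) / real (Suc n) + (mu (Suc K) i n - mu (Suc K) i (Suc n)))
      = mu (Suc K) i (Suc n) / real (Suc n)" for n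
  proof -
    have "c * mu (Suc K) i (Suc n) = mu K i (Suc n) + real (Suc n) * mu (Suc K) (Suc i) n"
      using mu_rec[of i K "Suc n"] by (simp add: c_def)
    hence "c * mu (Suc K) i (Suc n) / real (Suc n)
        = mu K i (Suc n) / real (Suc n) + mu (Suc K) (Suc i) n"
      by (simp add: add_divide_distrib del: of_nat_Suc)
    also have "mu (Suc K) (Suc i) n = mu (Suc K) i n - mu (Suc K) i (Suc n)"
      by (simp add: mu.simps(2))
    finally show ?thesis using c by (metis mult.commute nonzero_mult_div_cancel_right
        order_less_irrefl times_divide_eq_left times_divide_eq_right mult_1)
  qed
  moreover have "1 / c * (real K / c ^ Suc K + 1 / c ^ Suc K) = real (Suc K) / c ^ Suc (Suc K)"
    using c by (simp add: field_simps)
  ultimately show ?case by (simp only: c_def)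
qed

section \<open>Moments against 1/(2 - u) and the first series\<close>

text \<open>The integral of \<open>(1 - u) ^ n / (2 - u)\<close>, expanded as a geometric series in \<open>u / 2\<close>.\<close>

definition nu :: "nat \<Rightarrow> nat \<Rightarrow> real" where
  "nu K n = (\<Sum>i. mu K i n / 2 ^ Suc i)"

lemma nu_sums: "(\<lambda>i. mu K i n / 2 ^ Suc i) sums nu K n"
proof -
  have "summable (\<lambda>i. mu K i n / 2 ^ Suc i)"
  proof (rule summable_comparison_test)
    show "summable (\<lambda>i. (1 / 2) ^ Suc i :: real)"
      by (intro summable_mult summable_geometric iffD2[OF summable_Suc_iff]) simp
    have "norm (mu K i n / 2 ^ Suc i) \<le> (1 / 2) ^ Suc i" for i
      using mu_le_1[of K i n] mu_nonneg[of K i n] by (simp add: power_one_over divide_right_mono)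
    thus "\<exists>N. \<forall>i\<ge>N. norm (mu K i n / 2 ^ Suc i) \<le> (1 / 2) ^ Suc i" by blast
  qed
  thus ?thesis unfolding nu_def by (rule summable_sums)
qed

text \<open>This integrates (1 - u)^n (1 + (1 - u)) / (2 - u) = (1 - u)^n.\<close>

lemma nu_add: "nu K n + nu K (Suc n) = mu K 0 n"
proof -
  have "(\<lambda>i. mu K (Suc i) n / 2 ^ Suc (Suc i)) sums (nu K n - mu K 0 n / 2)"
    using nu_sums[of K n] by (subst sums_Suc_iff) simp
  \<comment> \<open>The factors 2 produce the numerator 2 mu_i - mu_(i+1) = mu_i + (mu_i - mu_(i+1))
    over 2^(i+1).\<close>
  from sums_diff[OF sums_mult[OF nu_sums[of K n], of 2] sums_mult[OF this, of 2]]
  have "(\<lambda>i. (mu K i n + mu K i (Suc n)) / 2 ^ Suc i) sums mu K 0 n"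
    by (simp add: mu.simps(2) field_simps)
  moreover have "(\<lambda>i. (mu K i n + mu K i (Suc n)) / 2 ^ Suc i) sums (nu K n + nu K (Suc n))"
    using sums_add[OF nu_sums[of K n] nu_sums[of K "Suc n"]] by (simp add: add_divide_distrib)
  ultimately show ?thesis by (rule sums_unique2[symmetric])
qed

lemma nu_nonneg: "nu K n \<ge> 0"
  by (rule sums_le[OF _ sums_zero nu_sums]) (simp add: mu_nonneg)

lemma nu_tendsto: "nu (Suc K) \<longlonglongrightarrow> 0"
proof (rule tendsto_sandwich[of "\<lambda>_. 0" _ _ "mu (Suc K) 0"])
  have "nu (Suc K) n \<le> mu (Suc K) 0 n" for n
    using nu_add[of "Suc K" n] nu_nonneg[of "Suc K" "Suc n"] by linarith
  thus "eventually (\<lambda>n. nu (Suc K) n \<le> mu (Suc K) 0 n) sequentially" by simp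
qed (simp_all add: nu_nonneg mu_tendsto_n)

lemma nu_0: "nu K 0 = polylog K (1 / 2)"
  unfolding nu_def polylog_def by (rule suminf_cong) (simp add: power_one_over field_simps)

text \<open>By \<open>nu_add\<close> the series telescopes to \<open>nu (Suc K) 0\<close>.\<close>

lemma alternating_mu_sums: "(\<lambda>n. (-1) ^ n * mu (Suc K) 0 n) sums polylog (Suc K) (1 / 2)"
proof -
  have "(\<lambda>n. (-1) ^ n * nu (Suc K) n) \<longlonglongrightarrow> 0"
    by (rule tendsto_rabs_zero_cancel)
      (use tendsto_rabs_zero[OF nu_tendsto] in \<open>simp add: abs_mult\<close>)
  from telescope_sums'[OF this]
  have "(\<lambda>n. (-1) ^ n * (nu (Suc K) n + nu (Suc K) (Suc n))) sums nu (Suc K) 0"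
    by (simp add: algebra_simps)
  thus ?thesis by (simp only: nu_add nu_0)
qed

lemma nu_1_0: "nu 1 0 = ln 2"
proof -
  have "(\<lambda>n. - ((- (- 1 / 2)) ^ n) / of_nat n) sums ln (1 + (- 1 / 2 :: real))"
    by (rule ln_series') simp
  hence "(\<lambda>n. (1 / 2) ^ n / of_nat n) sums (ln 2 :: real)"
    by (drule_tac sums_minus) (simp add: ln_div)
  \<comment> \<open>The dropped term at n = 0 is 1 / 0 = 0.\<close>
  hence "(\<lambda>n. (1 / 2) ^ Suc n / of_nat (Suc n)) sums (ln 2 :: real)"
    by (subst sums_Suc_iff) simp
  hence "polylog 1 (1 / 2) = ln 2"
    unfolding polylog_def by (simp add: sums_iff)
  thus ?thesis unfolding nu_0 .
qed

section \<open>Alternating harmonic numbers and the second series\<close>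

lemma alt_harm_0 [simp]: "alt_harm 0 = 0"
  by (simp add: alt_harm_def)

lemma alt_harm_Suc: "alt_harm (Suc n) = alt_harm n + (-1) ^ n / real (Suc n)"
  by (simp add: alt_harm_def)

lemma mu_1_0: "mu 1 0 n = 1 / real (Suc n)"
  using h_eq_mu[of 0 n] by (simp add: field_simps)

text \<open>The finite geometric sum of (-(1 - u))^k over k < n is (1 - (-1)^n (1 - u)^n) / (2 - u);
  \<open>nu\<close> is the integrated remainder.\<close>

lemma alt_harm_eq_nu: "alt_harm n = ln 2 - (-1) ^ n * nu 1 n"
proof (induction n)
  case 0
  show ?case using nu_1_0 by simp
next
  case (Suc n)
  have "nu 1 n + nu 1 (Suc n) = 1 / real (Suc n)" by (simp only: nu_add mu_1_0)
  hence "(-1) ^ n / real (Suc n) = (-1) ^ n * nu 1 n + (-1) ^ n * nu 1 (Suc n)"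
    by (simp only: distrib_left[symmetric]) simp
  thus ?case unfolding alt_harm_Suc Suc by simp
qed

lemma alt_harm_tendsto: "alt_harm \<longlonglongrightarrow> ln 2"
proof -
  have "(\<lambda>n. (-1) ^ n * nu 1 n) \<longlonglongrightarrow> 0"
    by (rule tendsto_rabs_zero_cancel)
      (use tendsto_rabs_zero[OF nu_tendsto[of 0]] in \<open>simp add: abs_mult\<close>)
  from tendsto_diff[OF tendsto_const this, of "ln 2"] show ?thesis
    by (simp add: alt_harm_eq_nu[abs_def])
qed

text \<open>Summation by parts via \<open>nu_add\<close>: the sign cancels that of the increment of
  \<open>alt_harm\<close>, leaving a series of nonnegative terms.\<close>

lemma alt_harm_nu_sum:
  "(\<Sum>n<N. (-1) ^ n * alt_harm (Suc n) * mu K 0 n)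
    = (\<Sum>n<N. nu K n / real (Suc n)) - (-1) ^ N * alt_harm N * nu K N"
proof (induction N)
  case (Suc N)
  have sq: "(-1) ^ N * (-1) ^ N = (1::real)" by (simp flip: power_add)
  have "(-1) ^ N * alt_harm (Suc N) * mu K 0 N =
     (-1) ^ N * alt_harm N * nu K N + ((-1) ^ N * (-1) ^ N) * nu K N / real (Suc N)
     + (-1) ^ N * alt_harm (Suc N) * nu K (Suc N)"
    unfolding nu_add[symmetric] distrib_left
    by (simp add: alt_harm_Suc algebra_simps del: of_nat_Suc)
  thus ?case unfolding sum.lessThan_Suc Suc sq by simp
qed simp

text \<open>Write (1 - u)^n / (2 - u) as (1 - u)^(n+1) (1/(1 - u) - 1/(2 - u)); the bracket has
  coefficients 1 - 1/2^(i+1). Summing over n first leaves -ln u, evaluated by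
  \<open>mu_div_sums\<close>.\<close>

lemma nu_div_sums:
  assumes "K \<ge> 1"
  shows "(\<lambda>n. nu K n / real (Suc n)) sums
    (real K * (riemann_zeta (real (K + 1)) - polylog (K + 1) (1 / 2)))"
proof (rule sums_nonneg_swap)
  show "mu K i (Suc n) * (1 - 1 / 2 ^ Suc i) / real (Suc n) \<ge> 0" for i n
    using one_le_power[of "2::real" "Suc i"]
    by (intro divide_nonneg_nonneg mult_nonneg_nonneg mu_nonneg) (simp_all add: divide_le_eq)
  show "(\<lambda>i. mu K i (Suc n) * (1 - 1 / 2 ^ Suc i) / real (Suc n)) sums (nu K n / real (Suc n))" for n
  proof -
    obtain L where K: "K = Suc L" using assms by (cases K) auto
    have "(\<lambda>i. mu K i (Suc n) - mu K i (Suc n) / 2 ^ Suc i) sums (mu K 0 n - nu K (Suc n))"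
      unfolding K by (intro sums_diff mu_sums_i nu_sums)
    thus ?thesis unfolding nu_add[symmetric]
      by (intro sums_divide) (simp add: algebra_simps)
  qed
  show "(\<lambda>n. mu K i (Suc n) * (1 - 1 / 2 ^ Suc i) / real (Suc n)) sums
      ((1 - 1 / 2 ^ Suc i) * (real K / real (Suc i) ^ Suc K))" for i
    using sums_mult[OF mu_div_sums, of "1 - 1 / 2 ^ Suc i" K i]
    by (simp add: mult_ac del: of_nat_Suc power_Suc)
  have "summable (\<lambda>n. inverse (real n ^ (K + 1)))"
    using assms by (intro inverse_power_summable) auto
  hence "summable (\<lambda>n. inverse (real (Suc n) ^ (K + 1)))"
    by (rule summable_Suc_iff[THEN iffD2])
  hence "(\<lambda>n. 1 / real (Suc n) ^ (K + 1)) sums (\<Sum>n. 1 / real (Suc n) ^ (K + 1))"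
    unfolding inverse_eq_divide by (rule summable_sums)
  moreover have "riemann_zeta (real (K + 1)) = (\<Sum>n. 1 / real (Suc n) ^ (K + 1))"
    unfolding riemann_zeta_def by (intro suminf_cong arg_cong2[of _ _ _ _ "(/)"] refl powr_realpow) simp
  ultimately have z: "(\<lambda>n. 1 / real (Suc n) ^ (K + 1)) sums riemann_zeta (real (K + 1))"
    by simp
  have "(\<lambda>i. (1 / 2) ^ Suc i / real (Suc i) ^ (K + 1)) sums polylog (K + 1) (1 / 2)"
    using nu_sums[of "K + 1" 0] unfolding nu_0
    by (simp add: power_one_over field_simps del: of_nat_Suc)
  from sums_mult[OF sums_diff[OF z this], of "real K"]
  show "(\<lambda>i. (1 - 1 / 2 ^ Suc i) * (real K / real (Suc i) ^ Suc K)) sums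
    (real K * (riemann_zeta (real (K + 1)) - polylog (K + 1) (1 / 2)))"
    by (simp add: power_one_over algebra_simps del: of_nat_Suc of_nat_add)
qed

lemma alternating_alt_harm_mu_sums:
  assumes "K \<ge> 1"
  shows "(\<lambda>n. (-1) ^ n * alt_harm (Suc n) * mu K 0 n) sums
    (real K * (riemann_zeta (real (K + 1)) - polylog (K + 1) (1 / 2)))"
proof -
  have "nu K \<longlonglongrightarrow> 0" using assms nu_tendsto[of "K - 1"] by simp
  hence "(\<lambda>N. alt_harm N * nu K N) \<longlonglongrightarrow> ln 2 * 0"
    by (intro tendsto_mult alt_harm_tendsto)
  hence "(\<lambda>N. \<bar>alt_harm N * nu K N\<bar>) \<longlonglongrightarrow> 0"
    by (simp add: tendsto_rabs_zero)
  hence "(\<lambda>N. (-1) ^ N * alt_harm N * nu K N) \<longlonglongrightarrow> 0"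
    by (intro tendsto_rabs_zero_cancel[of "\<lambda>N. (-1) ^ N * alt_harm N * nu K N"])
      (simp add: abs_mult)
  from tendsto_diff[OF nu_div_sums[OF assms, unfolded sums_def] this]
  show ?thesis unfolding sums_def alt_harm_nu_sum by simp
qed

section \<open>Stirling numbers against the moments\<close>

text \<open>The left side is the elementary symmetric polynomial e_m(1, 1/2, ..., 1/n), whose
  monomials all occur in h_m.\<close>

lemma stirling_le_h: "real (stirling (Suc n) (Suc m)) / fact n \<le> h m n"
proof (induction n arbitrary: m)
  case 0
  show ?case by (cases m) simp_all
next
  case (Suc n)
  have eq: "real (stirling (Suc (Suc n)) (Suc m)) / fact (Suc n)
      = real (stirling (Suc n) (Suc m)) / fact n + real (stirling (Suc n) m) / fact n / real (Suc n)"
    by (simp add: divide_simps del: stirling.simps(4) of_nat_Suc) (simp add: algebra_simps)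
  show ?case
  proof (cases m)
    case 0
    thus ?thesis using Suc[of 0] unfolding eq by simp
  next
    case (Suc l)
    have "real (stirling (Suc n) m) / fact n \<le> h l (Suc n)"
      using \<open>\<And>m. real (stirling (Suc n) (Suc m)) / fact n \<le> h m n\<close>[of l] h_mono[of l n] Suc by simp
    hence "real (stirling (Suc n) m) / fact n / real (Suc n) \<le> h l (Suc n) / real (Suc n)"
      by (rule divide_right_mono) simp
    thus ?thesis
      using \<open>\<And>m. real (stirling (Suc n) (Suc m)) / fact n \<le> h m n\<close>[of m] h_Suc_Suc[of l n]
      unfolding eq unfolding Suc by linarith
  qed
qed

lemma stirling_fact_tendsto: "(\<lambda>n. real (stirling n (Suc m)) / fact n) \<longlonglongrightarrow> 0"
proof (rule LIMSEQ_imp_Suc, rule tendsto_sandwich[of "\<lambda>_. 0" _ _ "mu (Suc m) 0"])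
  have "real (stirling (Suc n) (Suc m)) / fact (Suc n) \<le> mu (Suc m) 0 n" for n
  proof -
    have "real (stirling (Suc n) (Suc m)) / fact n \<le> real (Suc n) * mu (Suc m) 0 n"
      using stirling_le_h[of n m] h_mono[of m n] unfolding h_eq_mu by linarith
    hence "real (stirling (Suc n) (Suc m)) / fact n / real (Suc n) \<le> mu (Suc m) 0 n"
      by (simp add: pos_divide_le_eq mult_ac del: stirling.simps of_nat_Suc)
    thus ?thesis by (simp add: mult.commute del: stirling.simps of_nat_Suc)
  qed
  thus "eventually (\<lambda>n. real (stirling (Suc n) (Suc m)) / fact (Suc n) \<le> mu (Suc m) 0 n) sequentially"
    by simp
qed (simp_all add: mu_tendsto_n del: stirling.simps fact_Suc)

text \<open>The Stirling recurrence makes the differences of s(N, m+1) / (i+N)! telescope.\<close>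

lemma stirling_beta_partial:
  "real (Suc i) * (\<Sum>n<N. real (stirling n (Suc m)) / fact (i + n + 1))
    = (\<Sum>n<N. real (stirling n m) / fact (i + n + 1)) - real (stirling N (Suc m)) / fact (i + N)"
proof (induction N)
  case (Suc N)
  define F where "F = (fact (i + N) :: real)"
  have F: "F > 0" by (simp add: F_def)
  show ?case
    unfolding sum.lessThan_Suc distrib_left Suc using F
    by (simp add: F_def[symmetric] divide_simps) (simp add: algebra_simps)
qed simp

text \<open>Times i!, this is the moment of u^i against (-ln u)^m / m! expanded in powers of 1 - u.
  Each increment of m divides by i + 1.\<close>

lemma stirling_beta_sums:
  "(\<lambda>n. real (stirling n m) / fact (i + n + 1)) sums (1 / (fact i * real (Suc i) ^ Suc m))"
proof (induction m)
  case 0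
  have "real (stirling n 0) / fact (i + n + 1) = (if n = 0 then 1 / (fact i * real (Suc i) ^ Suc 0) else 0)" for n
    by (cases n) (simp_all add: mult.commute)
  thus ?case using sums_single[of 0 "\<lambda>_. 1 / (fact i * real (Suc i) ^ Suc 0)"] by simp
next
  case (Suc m)
  have "(\<lambda>N. real (stirling N (Suc m)) / fact (i + N)) \<longlonglongrightarrow> 0"
  proof (rule tendsto_sandwich[of "\<lambda>_. 0" _ _ "\<lambda>N. real (stirling N (Suc m)) / fact N"])
    show "eventually (\<lambda>N. real (stirling N (Suc m)) / fact (i + N) \<le> real (stirling N (Suc m)) / fact N) sequentially"
      by (intro always_eventually allI divide_left_mono fact_mono) auto
  qed (simp_all add: stirling_fact_tendsto)
  from tendsto_diff[OF Suc[unfolded sums_def] this]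
  have "(\<lambda>N. real (Suc i) * (\<Sum>n<N. real (stirling n (Suc m)) / fact (i + n + 1)))
      \<longlonglongrightarrow> 1 / (fact i * real (Suc i) ^ Suc m)"
    unfolding stirling_beta_partial by simp
  from tendsto_divide[OF this tendsto_const, of "real (Suc i)"] show ?case
    unfolding sums_def by (simp add: mult_ac)
qed

lemma mu_1: "mu 1 i n = fact i * fact n / fact (i + n + 1)"
proof (induction n)
  case 0
  show ?case by simp
next
  case (Suc n)
  have "real (Suc i + Suc n) * mu 1 i (Suc n) = real (Suc n) * mu 1 i n"
    using mu_rec'[of i "Suc n" 0] by simp
  hence "mu 1 i (Suc n) = real (Suc n) * mu 1 i n / real (Suc i + Suc n)"
    by (simp add: field_simps)
  thus ?case unfolding Suc by (simp add: field_simps)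
qed

text \<open>Expand 1/(2 - u) in powers of u and sum over n first.\<close>

lemma stirling_nu_sums: "(\<lambda>n. real (stirling n m) / fact n * nu 1 n) sums polylog (m + 1) (1 / 2)"
proof (rule sums_nonneg_swap)
  show "real (stirling n m) / fact n * (mu 1 i n / 2 ^ Suc i) \<ge> 0" for n i
    by (simp add: mu_nonneg)
  show "(\<lambda>i. real (stirling n m) / fact n * (mu 1 i n / 2 ^ Suc i)) sums
      (real (stirling n m) / fact n * nu 1 n)" for n
    by (intro sums_mult nu_sums)
  show "(\<lambda>n. real (stirling n m) / fact n * (mu 1 i n / 2 ^ Suc i)) sums
      (1 / real (Suc i) ^ (m + 1) / 2 ^ Suc i)" for i
  proof -
    have "fact i / 2 ^ Suc i * (real (stirling n m) / fact (i + n + 1))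
        = real (stirling n m) / fact n * (mu 1 i n / 2 ^ Suc i)" for n
      unfolding mu_1 by (simp add: mult_ac)
    thus ?thesis using sums_mult[OF stirling_beta_sums[of m i], of "fact i / 2 ^ Suc i"]
      by (simp add: mult_ac)
  qed
  show "(\<lambda>i. 1 / real (Suc i) ^ (m + 1) / 2 ^ Suc i) sums polylog (m + 1) (1 / 2)"
    using nu_sums[of "m + 1" 0] unfolding nu_0 by simp
qed

section \<open>The Stirling generating function up to the endpoint\<close>

definition stirling_gf :: "nat \<Rightarrow> nat \<Rightarrow> real \<Rightarrow> real" where
  "stirling_gf m N x = (\<Sum>n<N. real (stirling n m) / fact n * (-x) ^ n)"

text \<open>Truncated form of (1 + x) f' = -g; the Stirling recurrence leaves only the correction at
  the cut-off index N.\<close>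

lemma stirling_gf_deriv:
  assumes "x \<ge> 0"
  shows "((stirling_gf (Suc m) (Suc N)) has_real_derivative
    (- (stirling_gf m N x - real N * (real (stirling N (Suc m)) / fact N) * (-x) ^ N) / (1 + x))) (at x)"
proof -
  define E where "E N = (\<Sum>n<N. real (stirling (Suc n) (Suc m)) / fact n * (-x) ^ n)" for N
  have E: "(1 + x) * E N = stirling_gf m N x - real N * (real (stirling N (Suc m)) / fact N) * (-x) ^ N" for N
  proof (induction N)
    case (Suc N)
    define F where "F = (fact N :: real)"
    have F: "F > 0" by (simp add: F_def)
    have a: "E (Suc N) = E N + real (stirling (Suc N) (Suc m)) / fact N * (-x) ^ N"
      by (simp add: E_def)
    have b: "stirling_gf m (Suc N) x = stirling_gf m N x + real (stirling N m) / fact N * (-x) ^ N"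
      by (simp add: stirling_gf_def)
    show ?case unfolding a b distrib_left[of "1 + x"] Suc using F
      by (simp add: F_def[symmetric] divide_simps) (simp add: algebra_simps)
  qed (simp add: E_def stirling_gf_def)
  have "((stirling_gf (Suc m) (Suc N)) has_real_derivative
     (\<Sum>n<Suc N. real (stirling n (Suc m)) / fact n * (real n * (-x) ^ (n - 1) * - 1))) (at x)"
    unfolding stirling_gf_def[abs_def] by (auto intro!: derivative_eq_intros simp: mult_ac)
  also have "(\<Sum>n<Suc N. real (stirling n (Suc m)) / fact n * (real n * (-x) ^ (n - 1) * - 1)) = - E N"
    unfolding E_def sum.lessThan_Suc_shift sum_negf[symmetric]
    by (simp del: stirling.simps(4))
  also have "\<dots> = - (stirling_gf m N x - real N * (real (stirling N (Suc m)) / fact N) * (-x) ^ N) / (1 + x)"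
    unfolding E[symmetric] using assms by simp
  finally show ?thesis .
qed

text \<open>The endpoint \<open>x = 1\<close> lies on the circle of convergence. Uniform convergence up to it
  follows by induction on \<open>m\<close>: the limits satisfy \<open>(1 + x) f' = - g\<close> with \<open>f\<close> belonging to
  \<open>m + 1\<close> and \<open>g\<close> to \<open>m\<close>, and this holds for the partial sums up to a small error.\<close>

lemma stirling_gf_uniform_limit:
  "uniform_limit {0..1} (stirling_gf m) (\<lambda>x. (- ln (1 + x)) ^ m / fact m) sequentially"
proof (induction m)
  case 0
  have "stirling_gf 0 N x = 1" if pos: "N \<ge> 1" for N x
  proof -
    obtain M where N: "N = Suc M" by (cases N) (use pos in auto)
    show ?thesis unfolding stirling_gf_def N sum.lessThan_Suc_shift by simp
  qed
  thus ?case
    by (intro uniform_limitI eventually_sequentiallyI[of 1]) simp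
next
  case (Suc m)
  define e where "e N = real (stirling N (Suc m)) / fact N" for N
  define f where "f m x = (- ln (1 + x)) ^ m / fact m" for m and x :: real
  have e_nonneg: "e N \<ge> 0" for N by (simp add: e_def)
  have "uniform_limit {0..1} (\<lambda>N. stirling_gf (Suc m) (Suc N)) (f (Suc m)) sequentially"
  proof (rule uniform_limitI)
    fix r :: real assume r: "r > 0"
    have "eventually (\<lambda>N. e N < r / 2) sequentially"
      using order_tendstoD(2)[OF stirling_fact_tendsto[of m], of "r / 2"] r by (simp add: e_def)
    moreover have "eventually (\<lambda>N. \<forall>x\<in>{0..1}. dist (stirling_gf m N x) (f m x) < r / 2) sequentially"
      using uniform_limitD[OF Suc, of "r / 2"] r by (simp add: f_def)
    ultimately show "eventually (\<lambda>N. \<forall>x\<in>{0..1}. dist (stirling_gf (Suc m) (Suc N) x) (f (Suc m) x) < r) sequentially"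
    proof eventually_elim
      case (elim N)
      define D where "D y = stirling_gf (Suc m) (Suc N) y - f (Suc m) y" for y
      define D' where "D' y = - (stirling_gf m N y - f m y - real N * e N * (-y) ^ N) / (1 + y)" for y
      \<comment> \<open>\<open>B\<close> is an antiderivative of the bound \<open>B'\<close> on the
        error derivative. The cut-off term N e_N need not be small, but integrating y^N divides it
        by N + 1, leaving at most e_N.\<close>
      define B where "B y = r / 2 * y + real N / real (Suc N) * e N * y ^ Suc N" for y
      define B' where "B' y = r / 2 + real N * e N * y ^ N" for y
      have D: "(D has_real_derivative D' y) (at y)" if "y \<ge> 0" for y
      proof -
        have "(f (Suc m) has_real_derivative (- f m y / (1 + y))) (at y)"
        proof -
          have "((\<lambda>x. - ln (1 + x)) has_real_derivative - (1 / (1 + y))) (at y)"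
            using that by (auto intro!: derivative_eq_intros)
          from DERIV_cdivide[OF DERIV_power[OF this, of "Suc m"], of "fact (Suc m)"]
          show ?thesis unfolding f_def[abs_def]
            by (rule DERIV_cong) (simp add: mult_ac del: of_nat_Suc power_Suc)
        qed
        from DERIV_diff[OF stirling_gf_deriv[OF that, of m N] this] show ?thesis
          unfolding D_def[abs_def] D'_def e_def
          by (rule DERIV_cong) (simp add: diff_divide_distrib)
      qed
      have B: "(B has_real_derivative B' y) (at y)" for y
        unfolding B_def[abs_def] B'_def
        by (auto intro!: derivative_eq_intros simp del: power_Suc of_nat_Suc)
      have bound: "\<bar>D' y\<bar> \<le> B' y" if y: "y \<in> {0..1}" for y
      proof -
        have 1: "\<bar>stirling_gf m N y - f m y\<bar> \<le> r / 2"
          using elim(2) y by (force simp: dist_real_def)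
        have 2: "\<bar>real N * e N * (-y) ^ N\<bar> = real N * e N * y ^ N"
          using y e_nonneg[of N] by (simp add: abs_mult power_abs)
        have "\<bar>D' y\<bar> = \<bar>stirling_gf m N y - f m y - real N * e N * (-y) ^ N\<bar> / (1 + y)"
          using y unfolding D'_def by (simp add: abs_divide)
        also have "\<dots> \<le> \<bar>stirling_gf m N y - f m y - real N * e N * (-y) ^ N\<bar>"
          using y by (simp add: divide_le_eq mult_left_mono[of 1 "1 + y", simplified])
        also have "\<dots> \<le> B' y" using 1 2 unfolding B'_def by linarith
        finally show ?thesis .
      qed
      show ?case
      proof
        fix x :: real assume x: "x \<in> {0..1}"
        have zero: "D 0 = 0" "B 0 = 0"
          unfolding D_def B_def f_def stirling_gf_def sum.lessThan_Suc_shift by simp_all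
        \<comment> \<open>B - D and B + D vanish at 0 and are nondecreasing, hence |D| is at most
          B.\<close>
        have "B 0 - D 0 \<le> B x - D x"
        proof (rule DERIV_nonneg_imp_nondecreasing[where f = "\<lambda>y. B y - D y"])
          fix y assume "0 \<le> y" "y \<le> x"
          thus "\<exists>z. ((\<lambda>y. B y - D y) has_real_derivative z) (at y) \<and> z \<ge> 0"
            using bound[of y] x by (intro exI[of _ "B' y - D' y"] conjI DERIV_diff B D) auto
        qed (use x in auto)
        moreover have "B 0 + D 0 \<le> B x + D x"
        proof (rule DERIV_nonneg_imp_nondecreasing[where f = "\<lambda>y. B y + D y"])
          fix y assume "0 \<le> y" "y \<le> x"
          thus "\<exists>z. ((\<lambda>y. B y + D y) has_real_derivative z) (at y) \<and> z \<ge> 0"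
            using bound[of y] x by (intro exI[of _ "B' y + D' y"] conjI DERIV_add B D) auto
        qed (use x in auto)
        ultimately have "\<bar>D x\<bar> \<le> B x" using zero by linarith
        also have "\<dots> \<le> r / 2 + e N"
        proof -
          have "r / 2 * x \<le> r / 2" using x r by (simp add: mult_left_le)
          moreover have "real N / real (Suc N) * e N * x ^ Suc N \<le> 1 * e N * 1"
            using x e_nonneg[of N] by (intro mult_mono power_le_one) auto
          ultimately show ?thesis unfolding B_def by linarith
        qed
        also have "\<dots> < r" using elim(1) by linarith
        finally show "dist (stirling_gf (Suc m) (Suc N) x) (f (Suc m) x) < r"
          unfolding D_def dist_real_def .
      qed
    qed
  qed
  thus ?case unfolding f_def by (rule filterlim_sequentially_Suc[THEN iffD1])
qed

lemma alternating_stirling_sums: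
  "(\<lambda>n. (-1) ^ n * (real (stirling n m) / fact n)) sums ((- ln 2) ^ m / fact m)"
  using tendsto_uniform_limitI[OF stirling_gf_uniform_limit[of m], of 1]
  by (simp add: sums_def stirling_gf_def mult.commute)

section \<open>The three series\<close>

lemma sum_stirling_from_m:
  "(\<Sum>n=m..N. c n * real (stirling n m) / d n * e n) = (\<Sum>n<Suc N. c n * real (stirling n m) / d n * e n :: real)"
  by (rule sum.mono_neutral_left) auto

theorem theorem2p10:
  fixes m :: nat
  assumes "m \<ge> 1"
  shows "((\<lambda>N. \<Sum>n=1..N. Y m n / real n * (-1) ^ (n - 1))
            \<longlonglongrightarrow> fact m * polylog (m + 1) (1 / 2)) \<and>
         ((\<lambda>N. \<Sum>n=1..N. Y (m - 1) n * alt_harm n / real n * (-1) ^ (n - 1))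
            \<longlonglongrightarrow> fact m * (riemann_zeta (real (m + 1)) - polylog (m + 1) (1 / 2))) \<and>
         ((\<lambda>N. \<Sum>n=m..N. alt_harm n * real (stirling n m) / fact n * (-1) ^ (n - 1))
            \<longlonglongrightarrow> polylog (m + 1) (1 / 2) - (-1) ^ m / fact m * ln 2 ^ (m + 1))"
proof (intro conjI)
  obtain l where m: "m = Suc l" using assms by (cases m) auto
  have shift: "(\<Sum>n=1..N. a n) = (\<Sum>n<N. a (Suc n))" for a :: "nat \<Rightarrow> real" and N
    by (simp add: sum.atLeast1_atMost_eq)
  have "fact m * ((-1) ^ n * mu (Suc m) 0 n) = Y m (Suc n) / real (Suc n) * (-1) ^ (Suc n - 1)" for n
    by (simp add: Y_eq_h h_eq_mu del: of_nat_Suc)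
  thus "(\<lambda>N. \<Sum>n=1..N. Y m n / real n * (-1) ^ (n - 1)) \<longlonglongrightarrow> fact m * polylog (m + 1) (1 / 2)"
    using sums_mult[OF alternating_mu_sums[of m], of "fact m"] unfolding shift sums_def by simp
  have "fact l * ((-1) ^ n * alt_harm (Suc n) * mu m 0 n)
      = Y (m - 1) (Suc n) * alt_harm (Suc n) / real (Suc n) * (-1) ^ (Suc n - 1)" for n
    by (simp add: m Y_eq_h h_eq_mu del: of_nat_Suc)
  moreover have "fact l * (real m * a) = fact m * a" for a :: real
    by (simp add: m algebra_simps)
  ultimately show "(\<lambda>N. \<Sum>n=1..N. Y (m - 1) n * alt_harm n / real n * (-1) ^ (n - 1))
      \<longlonglongrightarrow> fact m * (riemann_zeta (real (m + 1)) - polylog (m + 1) (1 / 2))"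
    using sums_mult[OF alternating_alt_harm_mu_sums[OF assms], of "fact l"]
    unfolding shift sums_def by (simp only:)
  \<comment> \<open>For n >= 1 the signs (-1)^n and (-1)^(n-1) multiply to -1. At n = 0, where the
    exponent truncates, both sides vanish because s(0, m) = 0.\<close>
  have "real (stirling n m) / fact n * nu 1 n - ln 2 * ((-1) ^ n * (real (stirling n m) / fact n))
      = alt_harm n * real (stirling n m) / fact n * (-1) ^ (n - 1)" for n
  proof (cases n)
    case (Suc k)
    define q where "q = real (stirling n m) / fact n"
    have sq: "(-1) ^ k * (-1) ^ k = (1::real)" by (simp flip: power_add)
    have "alt_harm n * q * (-1) ^ (n - 1) = ln 2 * q * (-1) ^ k + ((-1) ^ k * (-1) ^ k) * nu 1 n * q"
      unfolding alt_harm_eq_nu[of n] by (simp add: Suc algebra_simps)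
    hence "q * nu 1 n - ln 2 * ((-1) ^ n * q) = alt_harm n * q * (-1) ^ (n - 1)"
      unfolding sq by (simp add: Suc)
    thus ?thesis by (simp add: q_def)
  qed (simp add: m)
  moreover have "ln 2 * ((- ln 2) ^ m / fact m :: real) = (-1) ^ m / fact m * ln 2 ^ (m + 1 :: nat)"
    by (simp add: power_minus[of "ln 2"])
  ultimately have "(\<lambda>n. alt_harm n * real (stirling n m) / fact n * (-1) ^ (n - 1)) sums
      (polylog (m + 1) (1 / 2) - (-1) ^ m / fact m * ln 2 ^ (m + 1))"
    using sums_diff[OF stirling_nu_sums[of m] sums_mult[OF alternating_stirling_sums[of m], of "ln 2"]]
    by (simp only:)
  thus "(\<lambda>N. \<Sum>n=m..N. alt_harm n * real (stirling n m) / fact n * (-1) ^ (n - 1))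
      \<longlonglongrightarrow> polylog (m + 1) (1 / 2) - (-1) ^ m / fact m * ln 2 ^ (m + 1)"
    unfolding sum_stirling_from_m sums_def by (rule LIMSEQ_Suc)
qed

end
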